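(* Let $(X,d)$ be a proper geodesic Gromov hyperbolic metric space. Let $f,g:X\to X$ be commuting $1$-Lipschitz maps. Suppose there exist $\xi_f\neq\xi_g\in\partial_G X$ and $x_0\in X$ such that $$\lim_{n\to\infty}f^n(x_0)=\xi_f\quad\text{and}\quad\lim_{n\to\infty}g^n(x_0)=\xi_g$$ in the Gromov compactification of $X$. Then there exist a totally geodesic closed subset $M\subset X$ and a $1$-Lipschitz map $\rho:X\to M$ such that: (1) $\rho\circ\rho=\rho$; (2) $f(M)=g(M)=M$, and $f|_M$ and $g|_M$ are isometries of $(M,d|_M)$.
   Context: $f^n$ denotes the $n$-th iterate of $f$; $f,g$ commute if $f\circ g=g\circ f$. A geodesic in $(X,d)$ is an isometric embedding of a real interval (a geodesic segment if the interval is $[a,b]$, a geodesic ray if it is $[0,+\infty)$). $(X,d)$ is proper if closed balls are compact and geodesic if any two points are joined by a geodesic segment. A proper geodesic metric space is Gromov hyperbolic if there is $\delta\ge 0$ such that in every geodesic triangle each side lies in the $\delta$-neighborhood of the union of the other two sides. A subset $M\subset X$ is totally geodesic if any two points of $M$ can be joined by a geodesic segment of $X$ contained in $M$. The Gromov boundary $\partial_G X$ is the set of geodesic rays from a fixed base point $o\in X$ modulo $\gamma\sim\lambda\Leftrightarrow\sup_{t\ge0}d(\gamma(t),\lambda(t))<\infty$. The Gromov compactification is $\overline{X}^G=X\cup\partial_G X$ with its usual compact Hausdorff topology: put $\mathrm{End}(\sigma)=[\sigma]$ for a ray $\sigma$ from $o$ and $\mathrm{End}(\sigma)=\sigma(R)$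 for a geodesic segment $\sigma:[0,R]\to X$ with $\sigma(0)=o$; then $\xi_n\to\xi$ iff for every choice of geodesics $\sigma_n$ from $o$ with $\mathrm{End}(\sigma_n)=\xi_n$, every subsequence of $(\sigma_n)$ has a further subsequence converging locally uniformly to a geodesic $\sigma$ with $\mathrm{End}(\sigma)=\xi$. This is independent of $o$. *)

theory Defs
  imports "HOL-Analysis.Analysis"
begin

text \<open>The metric space \<open>X\<close> is the universe of a type of class \<^class>\<open>metric_space\<close>.\<close>

definition isometric_on :: "'a::metric_space set \<Rightarrow> ('a \<Rightarrow> 'b::metric_space) \<Rightarrow> bool" where
  "isometric_on S f \<longleftrightarrow> (\<forall>x\<in>S. \<forall>y\<in>S. dist (f x) (f y) = dist x y)"

definition isometry_of :: "'a::metric_space set \<Rightarrow> ('a \<Rightarrow> 'a) \<Rightarrow> bool" where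
  "isometry_of M f \<longleftrightarrow> bij_betw f M M \<and> isometric_on M f"

definition geodesic_between :: "'a::metric_space set \<Rightarrow> 'a \<Rightarrow> 'a \<Rightarrow> bool" where
  "geodesic_between G x y \<longleftrightarrow>
     (\<exists>(\<gamma> :: real \<Rightarrow> 'a) a b. a \<le> b \<and> isometric_on {a..b} \<gamma> \<and> \<gamma> a = x \<and> \<gamma> b = y \<and> G = \<gamma> ` {a..b})"

definition totally_geodesic :: "'a::metric_space set \<Rightarrow> bool" where
  "totally_geodesic M \<longleftrightarrow> (\<forall>x\<in>M. \<forall>y\<in>M. \<exists>G. geodesic_between G x y \<and> G \<subseteq> M)"

definition proper_space :: "'a::metric_space itself \<Rightarrow> bool" where
  "proper_space _ \<longleftrightarrow> (\<forall>(x :: 'a) r. compact (cball x r))"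

definition geodesic_space :: "'a::metric_space itself \<Rightarrow> bool" where
  "geodesic_space _ \<longleftrightarrow> (\<forall>x y :: 'a. \<exists>G. geodesic_between G x y)"

text \<open>Closed neighborhoods are used, so that \<open>\<delta> = 0\<close> is allowed (as for trees).\<close>

definition nbhd :: "real \<Rightarrow> 'a::metric_space set \<Rightarrow> 'a set" where
  "nbhd \<delta> S = {x. \<exists>y\<in>S. dist x y \<le> \<delta>}"

definition gromov_hyperbolic :: "'a::metric_space itself \<Rightarrow> bool" where
  "gromov_hyperbolic _ \<longleftrightarrow>
     (\<exists>\<delta>\<ge>0. \<forall>(x :: 'a) y z A B C.
        geodesic_between A x y \<and> geodesic_between B y z \<and> geodesic_between C z x \<longrightarrow>
        A \<subseteq> nbhd \<delta> (B \<union> C) \<and> B \<subseteq> nbhd \<delta> (C \<union> A) \<and> C \<subseteq> nbhd \<delta> (A \<union> B))"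

definition rays_from :: "'a::metric_space \<Rightarrow> (real \<Rightarrow> 'a) set" where
  "rays_from p = {\<gamma>. isometric_on {0..} \<gamma> \<and> \<gamma> 0 = p}"

text \<open>Rays are total functions on \<^typ>\<open>real\<close> whose values at negative arguments are irrelevant;
  rays that differ only there are identified by the following relation.\<close>

definition asymp_rel :: "'a::metric_space \<Rightarrow> ((real \<Rightarrow> 'a) \<times> (real \<Rightarrow> 'a)) set" where
  "asymp_rel p = {(\<gamma>, \<eta>). \<gamma> \<in> rays_from p \<and> \<eta> \<in> rays_from p \<and>
                         bdd_above ((\<lambda>t. dist (\<gamma> t) (\<eta> t)) ` {0..})}"

definition gromov_boundary :: "'a::metric_space \<Rightarrow> (real \<Rightarrow> 'a) set set" where
  "gromov_boundary p = rays_from p // asymp_rel p"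

text \<open>The Gromov compactification with base point \<open>p\<close> consists of the points \<open>Point x\<close> and the
  points \<open>Bdry c\<close> with \<open>c \<in> gromov_boundary p\<close>.\<close>

datatype 'a gromov_pt = Point 'a | Bdry "(real \<Rightarrow> 'a) set"

definition gromov_compactification :: "'a::metric_space \<Rightarrow> 'a gromov_pt set" where
  "gromov_compactification p = range Point \<union> Bdry ` gromov_boundary p"

text \<open>\<open>Seg \<sigma> R\<close> is a segment parametrised by \<open>[0, R]\<close>, \<open>Ray \<sigma>\<close> a ray.\<close>

datatype 'a geod = Seg "real \<Rightarrow> 'a" real | Ray "real \<Rightarrow> 'a"

primrec geod_from :: "'a::metric_space \<Rightarrow> 'a geod \<Rightarrow> bool" where
  "geod_from p (Seg \<sigma> R) \<longleftrightarrow> 0 \<le> R \<and> isometric_on {0..R} \<sigma> \<and> \<sigma> 0 = p"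
| "geod_from p (Ray \<sigma>) \<longleftrightarrow> \<sigma> \<in> rays_from p"

primrec End :: "'a::metric_space \<Rightarrow> 'a geod \<Rightarrow> 'a gromov_pt" where
  "End p (Seg \<sigma> R) = Point (\<sigma> R)"
| "End p (Ray \<sigma>) = Bdry (asymp_rel p `` {\<sigma>})"

text \<open>To compare geodesics with different domains, a segment on \<open>[0, R]\<close> is extended to
  \<open>[0, \<infinity>)\<close> by its endpoint, which is the usual convention for locally uniform convergence.\<close>

primrec ext :: "'a geod \<Rightarrow> real \<Rightarrow> 'a" where
  "ext (Seg \<sigma> R) = (\<lambda>t. \<sigma> (min t R))"
| "ext (Ray \<sigma>) = \<sigma>"

definition locally_uniform_conv :: "(nat \<Rightarrow> 'a::metric_space geod) \<Rightarrow> 'a geod \<Rightarrow> bool" where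
  "locally_uniform_conv s l \<longleftrightarrow>
     (\<forall>K\<subseteq>{0..}. compact K \<longrightarrow> uniform_limit K (\<lambda>n. ext (s n)) (ext l) sequentially)"

definition gromov_converges ::
    "'a::metric_space \<Rightarrow> (nat \<Rightarrow> 'a gromov_pt) \<Rightarrow> 'a gromov_pt \<Rightarrow> bool" where
  "gromov_converges p \<xi> l \<longleftrightarrow>
     range \<xi> \<subseteq> gromov_compactification p \<and> l \<in> gromov_compactification p \<and>
     (\<forall>s. (\<forall>n. geod_from p (s n) \<and> End p (s n) = \<xi> n) \<longrightarrow>
        (\<forall>r :: nat \<Rightarrow> nat. strict_mono r \<longrightarrow>
           (\<exists>(q :: nat \<Rightarrow> nat) \<sigma>. strict_mono q \<and> geod_from p \<sigma> \<and> End p \<sigma> = l \<and>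
                  locally_uniform_conv (s \<circ> r \<circ> q) \<sigma>)))"

end

theory Submission
  imports Defs
begin

text \<open>Since \<open>\<xi>\<^sub>f \<noteq> \<xi>\<^sub>g\<close>, the Gromov products of \<open>f\<^sup>n x\<^sub>0\<close> and \<open>g\<^sup>m x\<^sub>0\<close> are bounded. If these two
  points are nearly equidistant from the base point, hyperbolicity and commutativity therefore
  force \<open>f\<^sup>n (g\<^sup>m x\<^sub>0)\<close> to stay in a bounded set. Hence the set of pointwise limits of \<open>f\<^sup>n g\<^sup>m\<close> as
  both \<open>n\<close> and \<open>m\<close> tend to infinity is nonempty. It is a commutative semigroup in which division
  is possible, that is, an abelian group under composition; its identity element \<open>\<rho>\<close> is the
  desired retraction, and \<open>f\<close> and \<open>g\<close> are invertible on the image of \<open>\<rho>\<close>.\<close>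

subsection \<open>Geodesics and slim triangles\<close>

text \<open>Names the constant, so that later bounds can be expressed in it. The inclusion is stated
  for one side; relabelling the triangle cyclically gives it for the others.\<close>

definition slim :: "'a::metric_space itself \<Rightarrow> real \<Rightarrow> bool" where
  "slim _ \<delta> \<longleftrightarrow> 0 \<le> \<delta> \<and> (\<forall>(x :: 'a) y z A B C.
     geodesic_between A x y \<and> geodesic_between B y z \<and> geodesic_between C z x \<longrightarrow>
     A \<subseteq> nbhd \<delta> (B \<union> C))"

lemma gromov_hyperbolic_slim:
  assumes "gromov_hyperbolic TYPE('a::metric_space)"
  obtains \<delta> where "slim TYPE('a) \<delta>"
proof -
  obtain \<delta> where "\<delta> \<ge> 0" and \<delta>: "\<And>(x::'a) y z A B C.
        geodesic_between A x y \<and> geodesic_between B y z \<and> geodesic_between C z x \<Longrightarrow>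
        A \<subseteq> nbhd \<delta> (B \<union> C)"
    using assms unfolding gromov_hyperbolic_def by meson
  then have "slim TYPE('a) \<delta>"
    unfolding slim_def by blast
  then show ?thesis by (rule that)
qed

lemma slimD:
  assumes "slim TYPE('a::metric_space) \<delta>" "geodesic_between A (x::'a) y"
    "geodesic_between B y z" "geodesic_between C z x"
  shows "A \<subseteq> nbhd \<delta> (B \<union> C)"
  using assms unfolding slim_def by blast

text \<open>Arc length parametrisation starting at time 0: the parameter is the distance from
  \<open>x\<close>, and \<open>Seg \<gamma> (dist x y)\<close> is a geodesic as in the
  compactification.\<close>

definition segment_param :: "(real \<Rightarrow> 'a::metric_space) \<Rightarrow> 'a \<Rightarrow> 'a \<Rightarrow> bool" where
  "segment_param \<gamma> x y \<longleftrightarrow>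
     isometric_on {0..dist x y} \<gamma> \<and> \<gamma> 0 = x \<and> \<gamma> (dist x y) = y"

lemma segment_param_dist:
  assumes "segment_param \<gamma> x y" "s \<in> {0..dist x y}" "t \<in> {0..dist x y}"
  shows "dist (\<gamma> s) (\<gamma> t) = \<bar>s - t\<bar>"
  using assms unfolding segment_param_def isometric_on_def by (simp add: dist_real_def)

lemma segment_param_geodesic:
  assumes "segment_param \<gamma> x y"
  shows "geodesic_between (\<gamma> ` {0..dist x y}) x y"
  using assms unfolding segment_param_def geodesic_between_def
  by (intro exI[of _ \<gamma>] exI[of _ 0] exI[of _ "dist x y"]) auto

lemma geodesic_between_param:
  assumes "geodesic_between G x y"
  obtains \<gamma> where "segment_param \<gamma> x y" "G = \<gamma> ` {0..dist x y}"
proof -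
  obtain \<gamma> and a b :: real where g: "a \<le> b" "isometric_on {a..b} \<gamma>" "\<gamma> a = x" "\<gamma> b = y" "G = \<gamma> ` {a..b}"
    using assms unfolding geodesic_between_def by blast
  have d: "dist x y = b - a"
    using g unfolding isometric_on_def by (force simp: dist_real_def)
  have "segment_param (\<lambda>t. \<gamma> (a + t)) x y"
    using g unfolding segment_param_def isometric_on_def d by (auto simp: dist_real_def)
  moreover have "G = (\<lambda>t. \<gamma> (a + t)) ` {0..dist x y}"
  proof -
    have "{a..b} = (+) a ` {0..b - a}"
      by simp
    then show ?thesis unfolding g(5) d by (metis image_image)
  qed
  ultimately show ?thesis by (rule that)
qed

lemma geodesic_between_sym:
  assumes "geodesic_between G x y"
  shows "geodesic_between G y x"
proof -
  obtain \<gamma> and a b :: real where g: "a \<le> b" "isometric_on {a..b} \<gamma>" "\<gamma> a = x" "\<gamma> b = y" "G = \<gamma> ` {a..b}"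
    using assms unfolding geodesic_between_def by blast
  have "G = (\<lambda>t. \<gamma> (- t)) ` {-b..-a}"
  proof -
    have "{a..b} = uminus ` {-b..-a}" by simp
    then show ?thesis unfolding g(5) by (metis image_image)
  qed
  moreover have "isometric_on {-b..-a} (\<lambda>t. \<gamma> (- t))"
    using g(2) unfolding isometric_on_def by (auto simp: dist_real_def)
  ultimately show ?thesis
    unfolding geodesic_between_def using g
    by (intro exI[of _ "\<lambda>t. \<gamma> (- t)"] exI[of _ "-b"] exI[of _ "-a"]) auto
qed

lemma geodesic_between_add:
  assumes "geodesic_between G x y" "w \<in> G"
  shows "dist x w + dist w y = dist x y"
proof -
  obtain \<gamma> where g: "segment_param \<gamma> x y" "G = \<gamma> ` {0..dist x y}"
    using assms(1) by (rule geodesic_between_param)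
  then obtain t where t: "t \<in> {0..dist x y}" "w = \<gamma> t" using assms(2) by auto
  then have "dist (\<gamma> 0) (\<gamma> t) = t" "dist (\<gamma> t) (\<gamma> (dist x y)) = dist x y - t"
    by (simp_all add: segment_param_dist[OF g(1)])
  then show ?thesis using g(1) t unfolding segment_param_def by auto
qed

lemma geodesic_between_dist:
  assumes "geodesic_between G x y" "w \<in> G" "w' \<in> G"
  shows "dist w w' = \<bar>dist x w - dist x w'\<bar>"
proof -
  obtain \<gamma> where g: "segment_param \<gamma> x y" "G = \<gamma> ` {0..dist x y}"
    using assms(1) by (rule geodesic_between_param)
  then obtain s t where t: "t \<in> {0..dist x y}" "w = \<gamma> t" "s \<in> {0..dist x y}" "w' = \<gamma> s"
    using assms(2,3) by auto
  then have "dist (\<gamma> 0) (\<gamma> t) = t" "dist (\<gamma> 0) (\<gamma> s) = s" "dist (\<gamma> t) (\<gamma> s) = \<bar>t - s\<bar>"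
    by (simp_all add: segment_param_dist[OF g(1)])
  then show ?thesis using g(1) t unfolding segment_param_def by simp
qed

lemma geodesic_between_ends:
  assumes "geodesic_between G x y"
  shows "x \<in> G" "y \<in> G"
  using assms unfolding geodesic_between_def by force+

section \<open>Points close to a side of a slim triangle\<close>

lemma infdist_less_attain:
  assumes "infdist x A < r" "A \<noteq> {}"
  obtains a where "a \<in> A" "dist x a < r"
proof -
  have "\<exists>a\<in>A. dist x a < r"
    using assms cINF_less_iff[of A "dist x" r] by (auto simp: infdist_notempty)
  then show ?thesis using that by blast
qed

text \<open>The two closed sets of points \<open>\<delta>\<close>-close to \<open>A\<close> and to \<open>B\<close> cover the connected
  segment \<open>G\<close>, so they meet.\<close>

lemma slim_meet:
  assumes \<delta>: "slim TYPE('a::metric_space) \<delta>" and G: "geodesic_between G (u::'a) v"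
    and A: "geodesic_between A u x" and B: "geodesic_between B x v"
  obtains w where "w \<in> G" "infdist w A \<le> \<delta>" "infdist w B \<le> \<delta>"
proof -
  have \<delta>0: "0 \<le> \<delta>" using \<delta> unfolding slim_def by simp
  obtain \<gamma> where g: "segment_param \<gamma> u v" "G = \<gamma> ` {0..dist u v}"
    using G by (rule geodesic_between_param)
  have cont: "continuous_on {0..dist u v} \<gamma>"
  proof (rule continuous_onI)
    fix t e :: real assume "t \<in> {0..dist u v}" "0 < e"
    then show "\<exists>d>0. \<forall>s\<in>{0..dist u v}. dist s t < d \<longrightarrow> dist (\<gamma> s) (\<gamma> t) \<le> e"
      by (intro exI[of _ e]) (auto simp: segment_param_dist[OF g(1)] dist_real_def)
  qed
  have conn: "connected G"
    unfolding g(2) by (intro connected_continuous_image cont) simp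
  have cl: "closed {w. infdist w S \<le> \<delta>}" for S :: "'a set"
    by (intro closed_Collect_le continuous_intros)
  have sub: "G \<subseteq> {w. infdist w A \<le> \<delta>} \<union> {w. infdist w B \<le> \<delta>}"
  proof
    fix w assume "w \<in> G"
    then have "w \<in> nbhd \<delta> (B \<union> A)"
      using slimD[OF \<delta> G geodesic_between_sym[OF B] geodesic_between_sym[OF A]] by blast
    then obtain y where "y \<in> B \<union> A" "dist w y \<le> \<delta>" unfolding nbhd_def by blast
    then show "w \<in> {w. infdist w A \<le> \<delta>} \<union> {w. infdist w B \<le> \<delta>}"
      using infdist_le2[of y B w \<delta>] infdist_le2[of y A w \<delta>] by auto
  qed
  have u: "u \<in> {w. infdist w A \<le> \<delta>} \<inter> G"
    using geodesic_between_ends[OF A] geodesic_between_ends[OF G] \<delta>0 by simp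
  have v: "v \<in> {w. infdist w B \<le> \<delta>} \<inter> G"
    using geodesic_between_ends[OF B] geodesic_between_ends[OF G] \<delta>0 by simp
  have "{w. infdist w A \<le> \<delta>} \<inter> {w. infdist w B \<le> \<delta>} \<inter> G \<noteq> {}"
    using connected_closedD[OF conn _ sub cl cl] u v by blast
  then show ?thesis using that by blast
qed

text \<open>A point \<open>w\<close> of \<open>G\<close> is close to some \<open>a\<close> on a
  geodesic from \<open>u\<close> to \<open>x\<close> and to some \<open>b\<close> on one from
  \<open>x\<close> to \<open>v\<close>. Going from \<open>u\<close> to \<open>v\<close> through
  \<open>a\<close>, \<open>w\<close>, \<open>b\<close> almost skips the detour from \<open>a\<close>
  via \<open>x\<close> to \<open>b\<close>, so that detour is short and \<open>a\<close> is close to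
  \<open>x\<close>.\<close>

lemma slim_near_geodesic:
  assumes \<delta>: "slim TYPE('a::metric_space) \<delta>" and X: "geodesic_space TYPE('a)"
    and G: "geodesic_between G (u::'a) v"
    and le: "dist u x + dist x v \<le> dist u v + C"
  obtains w where "w \<in> G" "dist x w \<le> C + 3 * \<delta> + 3"
proof -
  obtain A B where A: "geodesic_between A u x" and B: "geodesic_between B x v"
    using X unfolding geodesic_space_def by blast
  obtain w where w: "w \<in> G" "infdist w A \<le> \<delta>" "infdist w B \<le> \<delta>"
    using slim_meet[OF \<delta> G A B] .
  \<comment> \<open>The slack 1 turns a bound on the infimum into an actual point.\<close>
  obtain a where a: "a \<in> A" "dist w a < \<delta> + 1"
    using infdist_less_attain[of w A "\<delta> + 1"] w geodesic_between_ends[OF A] by force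
  obtain b where b: "b \<in> B" "dist w b < \<delta> + 1"
    using infdist_less_attain[of w B "\<delta> + 1"] w geodesic_between_ends[OF B] by force
  have "dist u v \<le> dist u a + dist w a + dist w b + dist b v"
    by metric
  moreover have "dist x w \<le> dist a x + dist w a" by metric
  ultimately have "dist x w \<le> C + 3 * \<delta> + 3"
    using a b le geodesic_between_add[OF A a(1)] geodesic_between_add[OF B b(1)]
      zero_le_dist[of x b] by linarith
  with w(1) show ?thesis by (rule that)
qed

text \<open>Both \<open>p\<close> and \<open>z\<close> are near a geodesic from \<open>u\<close> to \<open>v\<close>, at nearly the same
  distance from \<open>u\<close>.\<close>

lemma slim_exchange:
  assumes \<delta>: "slim TYPE('a::metric_space) \<delta>" and X: "geodesic_space TYPE('a)"
    and C: "dist u p + dist p v \<le> dist u (v::'a) + C"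
    and D: "dist u z \<le> dist p v + D" "dist z v \<le> dist u p + D"
    and K: "\<bar>dist u p - dist p v\<bar> \<le> K"
  shows "dist p z \<le> K + 5 * C + 5 * D + 12 * \<delta> + 12"
proof -
  obtain G where G: "geodesic_between G u v"
    using X unfolding geodesic_space_def by blast
  obtain w where w: "w \<in> G" "dist p w \<le> C + 3 * \<delta> + 3"
    using slim_near_geodesic[OF \<delta> X G C] .
  have "dist u z + dist z v \<le> dist u v + (C + 2 * D)"
    using C D by linarith
  then obtain w' where w': "w' \<in> G" "dist z w' \<le> C + 2 * D + 3 * \<delta> + 3"
    using slim_near_geodesic[OF \<delta> X G] by blast
  \<comment> \<open>\<open>dist u w\<close> is close to \<open>dist u p\<close>, and
    \<open>dist u w'\<close> to \<open>dist p v\<close>; these differ by at most \<open>K\<close>,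
    which bounds \<open>dist w w'\<close> along \<open>G\<close>. The last inequality yields
    \<open>0 \<le> C\<close>.\<close>
  have "dist u w \<le> dist u p + dist p w" "dist u p \<le> dist u w + dist p w"
    "dist u w' \<le> dist u z + dist z w'" "dist w' v \<le> dist z v + dist z w'"
    "dist p z \<le> dist p w + dist w w' + dist z w'" "dist u v \<le> dist u p + dist p v"
    by metric+
  then show ?thesis
    using w w' C D K geodesic_between_add[OF G w'(1)]
      geodesic_between_dist[OF G w(1) w'(1)] by linarith
qed

text \<open>The hypothesis says that \<open>t + \<delta>\<close> is below the Gromov product of
  \<open>u\<close> and \<open>v\<close> at \<open>p\<close>. Every point of a geodesic from
  \<open>u\<close> to \<open>v\<close> is at least that product away from \<open>p\<close>, so
  slimness puts \<open>\<alpha> t\<close> near some \<open>\<beta> s\<close>. Comparing distances to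
  \<open>p\<close> gives \<open>\<bar>s - t\<bar> \<le> \<delta>\<close>.\<close>

lemma slim_fellow_travel:
  assumes \<delta>: "slim TYPE('a::metric_space) \<delta>" and X: "geodesic_space TYPE('a)"
    and \<alpha>: "segment_param \<alpha> p (u::'a)" and \<beta>: "segment_param \<beta> p v"
    and t: "0 \<le> t" "2 * t + 2 * \<delta> < dist p u + dist p v - dist u v"
  shows "dist (\<alpha> t) (\<beta> t) \<le> 2 * \<delta>"
proof -
  have \<delta>0: "0 \<le> \<delta>" using \<delta> unfolding slim_def by simp
  have "dist p u \<le> dist p v + dist u v" "dist p v \<le> dist p u + dist u v" by metric+
  then have tu: "t \<in> {0..dist p u}" and tv: "t \<in> {0..dist p v}"
    using t \<delta>0 by auto
  obtain G where G: "geodesic_between G u v"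
    using X unfolding geodesic_space_def by blast
  have "\<alpha> ` {0..dist p u} \<subseteq> nbhd \<delta> (G \<union> \<beta> ` {0..dist p v})"
    using slimD[OF \<delta> segment_param_geodesic[OF \<alpha>] G
        geodesic_between_sym[OF segment_param_geodesic[OF \<beta>]]] .
  then obtain y where y: "y \<in> G \<union> \<beta> ` {0..dist p v}" "dist (\<alpha> t) y \<le> \<delta>"
    using tu unfolding nbhd_def by blast
  have pt: "dist p (\<alpha> t) = t"
    using segment_param_dist[OF \<alpha>, of 0 t] tu \<alpha> unfolding segment_param_def by auto
  have "y \<notin> G"
  proof
    assume "y \<in> G"
    then have "dist u y + dist y v = dist u v" using geodesic_between_add[OF G] by simp
    moreover have "dist p u \<le> dist p y + dist u y" "dist p v \<le> dist p y + dist y v"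
      "dist p y \<le> dist p (\<alpha> t) + dist (\<alpha> t) y" by metric+
    ultimately show False using t(2) pt y(2) by linarith
  qed
  then obtain s where s: "s \<in> {0..dist p v}" "y = \<beta> s" using y by blast
  have ps: "dist p (\<beta> s) = s"
    using segment_param_dist[OF \<beta>, of 0 s] s \<beta> unfolding segment_param_def by auto
  have "\<bar>dist p (\<alpha> t) - dist p y\<bar> \<le> dist (\<alpha> t) y" by metric
  then have "dist (\<beta> s) (\<beta> t) \<le> \<delta>"
    using segment_param_dist[OF \<beta> s(1) tv] pt ps s y(2) by simp
  moreover have "dist (\<alpha> t) (\<beta> t) \<le> dist (\<alpha> t) y + dist y (\<beta> t)" by metric
  ultimately show ?thesis using s y(2) by simp
qed

subsection \<open>Convergence to boundary points\<close>

text \<open>Locally uniform convergence is used on singletons only. The limit geodesic is a ray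
  because segments end in a \<open>Point\<close>; the \<open>min\<close> is the constant extension
  of segments made by \<open>ext\<close>.\<close>

lemma gromov_converges_boundary_subseq:
  assumes conv: "gromov_converges p (\<lambda>n. Point (u n)) (Bdry \<xi>)"
    and c: "\<And>n. segment_param (c n) p (u n)"
    and r: "strict_mono (r :: nat \<Rightarrow> nat)"
  shows "\<exists>q \<sigma>. strict_mono (q :: nat \<Rightarrow> nat) \<and> \<sigma> \<in> rays_from p \<and> \<xi> = asymp_rel p `` {\<sigma>} \<and>
    (\<forall>t\<ge>0. (\<lambda>j. c (r (q j)) (min t (dist p (u (r (q j)))))) \<longlonglongrightarrow> \<sigma> t)"
proof -
  define s where "s n = Seg (c n) (dist p (u n))" for n
  have "\<forall>n. geod_from p (s n) \<and> End p (s n) = Point (u n)"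
    using c unfolding s_def segment_param_def by simp
  then obtain q l where q: "strict_mono (q :: nat \<Rightarrow> nat)" "geod_from p l" "End p l = Bdry \<xi>"
    "locally_uniform_conv (s \<circ> r \<circ> q) l"
    using conv r unfolding gromov_converges_def by meson
  from q(3) obtain \<sigma> where \<sigma>: "l = Ray \<sigma>" "\<xi> = asymp_rel p `` {\<sigma>}"
    by (cases l) auto
  show ?thesis
  proof (intro exI conjI allI impI)
    show "strict_mono q" by fact
    show "\<sigma> \<in> rays_from p" using q(2) \<sigma> by simp
    show "\<xi> = asymp_rel p `` {\<sigma>}" by fact
    fix t :: real assume "0 \<le> t"
    then have "uniform_limit {t} (\<lambda>n. ext ((s \<circ> r \<circ> q) n)) (ext l) sequentially"
      using q(4) unfolding locally_uniform_conv_def by (meson compact_insert compact_empty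
          atLeast_iff empty_subsetI insert_subset)
    then have "(\<lambda>n. ext ((s \<circ> r \<circ> q) n) t) \<longlonglongrightarrow> ext l t"
      by (rule tendsto_uniform_limitI) simp
    then show "(\<lambda>j. c (r (q j)) (min t (dist p (u (r (q j)))))) \<longlonglongrightarrow> \<sigma> t"
      by (simp add: s_def \<sigma>)
  qed
qed

lemma geodesic_space_segment_params:
  assumes "geodesic_space TYPE('a::metric_space)"
  obtains c where "\<And>n. segment_param (c n) (p::'a) (u n)"
proof -
  have "\<exists>\<gamma>. segment_param \<gamma> p (u n)" for n
    using assms geodesic_between_param unfolding geodesic_space_def by metis
  then show ?thesis using that by metis
qed

text \<open>If the points stayed within distance \<open>R\<close> of \<open>p\<close>, the extended
  segments would be constant from time \<open>R\<close> on, and so would the limit ray.\<close>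

lemma gromov_converges_boundary_unbounded:
  assumes X: "geodesic_space TYPE('a::metric_space)"
    and conv: "gromov_converges (p::'a) (\<lambda>n. Point (u n)) (Bdry \<xi>)"
  shows "\<exists>n\<ge>k. R < dist p (u n)"
proof (rule ccontr)
  assume "\<not> ?thesis"
  then have bd: "\<And>n. n \<ge> k \<Longrightarrow> dist p (u n) \<le> R" by force
  obtain c where c: "\<And>n. segment_param (c n) p (u n)"
    using geodesic_space_segment_params[OF X] by blast
  \<comment> \<open>The shift discards the initial terms, for which no bound is assumed.\<close>
  have "strict_mono (\<lambda>n. n + k)" by (simp add: strict_mono_def)
  from gromov_converges_boundary_subseq[OF conv c this]
  obtain q \<sigma> where q: "strict_mono (q :: nat \<Rightarrow> nat)" "\<sigma> \<in> rays_from p"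
    "\<xi> = asymp_rel p `` {\<sigma>}"
    "\<forall>t\<ge>0. (\<lambda>j. c (q j + k) (min t (dist p (u (q j + k))))) \<longlonglongrightarrow> \<sigma> t"
    by (elim exE conjE)
  have R: "0 \<le> R" using bd[of k] zero_le_dist[of p "u k"] by linarith
  have "min R (dist p (u (n + k))) = min (R + 1) (dist p (u (n + k)))" for n
    using bd[of "n + k"] by auto
  then have "\<sigma> R = \<sigma> (R + 1)"
    using q(4)[rule_format, of R] q(4)[rule_format, of "R + 1"] R by (auto dest: LIMSEQ_unique)
  moreover have "dist (\<sigma> R) (\<sigma> (R + 1)) = dist R (R + 1)"
    using q(2) R unfolding rays_from_def isometric_on_def by simp
  ultimately show False by (simp add: dist_real_def)
qed

text \<open>If the Gromov products of the two sequences were unbounded, then geodesics from \<open>p\<close> to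
  suitable members of them would fellow travel for longer and longer times, and the limiting rays
  would be asymptotic.\<close>

lemma gromov_product_bounded:
  assumes \<delta>: "slim TYPE('a::metric_space) \<delta>" and X: "geodesic_space TYPE('a)"
    and u: "gromov_converges (p::'a) (\<lambda>n. Point (u n)) (Bdry \<xi>)"
    and v: "gromov_converges p (\<lambda>n. Point (v n)) (Bdry \<eta>)"
    and ne: "\<xi> \<noteq> \<eta>"
  shows "\<exists>C N. \<forall>n\<ge>N. \<forall>m\<ge>N. dist p (u n) + dist p (v m) \<le> dist (u n) (v m) + C"
proof (rule ccontr)
  assume neg: "\<not> ?thesis"
  let ?g = "\<lambda>n m. dist p (u n) + dist p (v m) - dist (u n) (v m)"
  \<comment> \<open>Failure of the claim for the constant and the threshold both equal to
    \<open>k\<close>.\<close>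
  have far: "\<exists>n m. k \<le> n \<and> k \<le> m \<and> real k < ?g n m" for k
  proof (rule ccontr)
    assume "\<not> ?thesis"
    then have "\<forall>n\<ge>k. \<forall>m\<ge>k. dist p (u n) + dist p (v m) \<le> dist (u n) (v m) + real k"
      by force
    with neg show False by blast
  qed
  \<comment> \<open>Both indices are made strictly increasing, so that each gives a
    subsequence.\<close>
  have "\<exists>w. \<forall>k. (case w k of (n, m) \<Rightarrow> real k < ?g n m) \<and>
          fst (w k) < fst (w (Suc k)) \<and> snd (w k) < snd (w (Suc k))"
  proof (rule dependent_nat_choice)
    show "\<exists>w. case w of (n, m) \<Rightarrow> real 0 < ?g n m"
      using far[of 0] by auto
    fix w :: "nat \<times> nat" and k :: nat
    obtain n m where "Suc (k + fst w + snd w) \<le> n" "Suc (k + fst w + snd w) \<le> m"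
      "real (Suc (k + fst w + snd w)) < ?g n m"
      using far by blast
    then show "\<exists>y. (case y of (n, m) \<Rightarrow> real (Suc k) < ?g n m) \<and> fst w < fst y \<and> snd w < snd y"
      by (intro exI[of _ "(n, m)"]) auto
  qed
  then obtain w where w: "\<And>k. real k < ?g (fst (w k)) (snd (w k))"
    "\<And>k. fst (w k) < fst (w (Suc k))" "\<And>k. snd (w k) < snd (w (Suc k))"
    by (auto simp: case_prod_beta)
  define n m where "n k = fst (w k)" and "m k = snd (w k)" for k
  have n: "strict_mono n" and m: "strict_mono m" and g: "\<And>k. real k < ?g (n k) (m k)"
    using w by (auto simp: strict_mono_Suc_iff n_def m_def)
  obtain c where c: "\<And>n. segment_param (c n) p (u n)"
    using geodesic_space_segment_params[OF X] by blast
  obtain d where d: "\<And>n. segment_param (d n) p (v n)"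
    using geodesic_space_segment_params[OF X] by blast
  obtain q \<sigma> where q: "strict_mono (q :: nat \<Rightarrow> nat)" "\<sigma> \<in> rays_from p" "\<xi> = asymp_rel p `` {\<sigma>}"
    "\<forall>t\<ge>0. (\<lambda>j. c (n (q j)) (min t (dist p (u (n (q j)))))) \<longlonglongrightarrow> \<sigma> t"
    using gromov_converges_boundary_subseq[OF u c n] by (elim exE conjE)
  \<comment> \<open>The second extraction is made inside the first, so that both families of
    geodesics converge along \<open>q \<circ> q'\<close>.\<close>
  have mq: "strict_mono (m \<circ> q)" using m q(1) by (rule strict_mono_o)
  obtain q' \<tau> where q': "strict_mono (q' :: nat \<Rightarrow> nat)" "\<tau> \<in> rays_from p" "\<eta> = asymp_rel p `` {\<tau>}"
    "\<forall>t\<ge>0. (\<lambda>j. d (m (q (q' j))) (min t (dist p (v (m (q (q' j))))))) \<longlonglongrightarrow> \<tau> t"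
    using gromov_converges_boundary_subseq[OF v d mq, unfolded o_apply] by (elim exE conjE)
  have close: "dist (\<sigma> t) (\<tau> t) \<le> 2 * \<delta>" if t: "0 \<le> t" for t
  proof -
    let ?a = "\<lambda>j. c (n (q (q' j))) (min t (dist p (u (n (q (q' j))))))"
    let ?b = "\<lambda>j. d (m (q (q' j))) (min t (dist p (v (m (q (q' j))))))"
    have "?a \<longlonglongrightarrow> \<sigma> t"
      using LIMSEQ_subseq_LIMSEQ[OF q(4)[rule_format, OF t] q'(1)] by (simp add: o_def)
    then have lim: "(\<lambda>j. dist (?a j) (?b j)) \<longlonglongrightarrow> dist (\<sigma> t) (\<tau> t)"
      using q'(4)[rule_format, OF t] by (rule tendsto_dist)
    obtain J :: nat where J: "2 * t + 2 * \<delta> < real J" using reals_Archimedean2 by blast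
    have "dist (?a j) (?b j) \<le> 2 * \<delta>" if "J \<le> j" for j
    proof -
      let ?k = "q (q' j)"
      have "j \<le> ?k" using seq_suble[OF q(1), of "q' j"] seq_suble[OF q'(1), of j] by linarith
      then have gt: "2 * t + 2 * \<delta> < ?g (n ?k) (m ?k)" using J that g[of ?k] by linarith
      have "0 \<le> \<delta>" using \<delta> unfolding slim_def by simp
      moreover have "dist p (u (n ?k)) \<le> dist p (v (m ?k)) + dist (u (n ?k)) (v (m ?k))"
        "dist p (v (m ?k)) \<le> dist p (u (n ?k)) + dist (u (n ?k)) (v (m ?k))" by metric+
      ultimately have "t \<le> dist p (u (n ?k))" "t \<le> dist p (v (m ?k))"
        using gt by linarith+
      then show ?thesis
        using slim_fellow_travel[OF \<delta> X c d t gt] by simp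
    qed
    then show ?thesis using lim LIMSEQ_le_const2 by blast
  qed
  \<comment> \<open>Being asymptotic to a given ray survives replacing a ray by one within
    \<open>2 * \<delta>\<close>; hence \<open>\<sigma>\<close> and \<open>\<tau>\<close> have the
    same class.\<close>
  have transfer: "bdd_above ((\<lambda>t. dist (\<beta> t) (\<rho> t)) ` {0..})"
    if cl: "\<And>t. 0 \<le> t \<Longrightarrow> dist (\<alpha> t) (\<beta> t) \<le> 2 * \<delta>"
      and bd: "bdd_above ((\<lambda>t. dist (\<alpha> t) (\<rho> t)) ` {0..})" for \<alpha> \<beta> \<rho> :: "real \<Rightarrow> 'a"
  proof -
    obtain B where B: "\<And>t. 0 \<le> t \<Longrightarrow> dist (\<alpha> t) (\<rho> t) \<le> B"
      using bd by (auto simp: bdd_above_def)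
    show ?thesis
    proof (rule bdd_aboveI2)
      fix t :: real assume "t \<in> {0..}"
      then show "dist (\<beta> t) (\<rho> t) \<le> 2 * \<delta> + B"
        using B[of t] cl[of t] dist_triangle3[of "\<beta> t" "\<rho> t" "\<alpha> t"] by simp
    qed
  qed
  have "bdd_above ((\<lambda>t. dist (\<sigma> t) (\<rho> t)) ` {0..}) \<longleftrightarrow>
      bdd_above ((\<lambda>t. dist (\<tau> t) (\<rho> t)) ` {0..})" for \<rho>
    using transfer[of \<sigma> \<tau> \<rho>] transfer[of \<tau> \<sigma> \<rho>] close by (auto simp: dist_commute)
  then have "\<xi> = \<eta>"
    unfolding q(3) q'(3) asymp_rel_def using q(2) q'(2) by auto
  with ne show False by simp
qed

text \<open>A discrete intermediate value argument: take \<open>v m\<close> farther from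
  \<open>p\<close> than \<open>u k\<close>, then the first \<open>n \<ge> k\<close> with
  \<open>u n\<close> farther than \<open>v m\<close>. The overshoot is at most one step of
  \<open>u\<close>, hence at most \<open>K\<close>.\<close>

lemma gromov_converges_boundary_balanced:
  assumes \<delta>: "slim TYPE('a::metric_space) \<delta>" and X: "geodesic_space TYPE('a)"
    and u: "gromov_converges (p::'a) (\<lambda>n. Point (u n)) (Bdry \<xi>)"
    and v: "gromov_converges p (\<lambda>n. Point (v n)) (Bdry \<eta>)"
    and ne: "\<xi> \<noteq> \<eta>" and step: "\<And>n. dist (u n) (u (Suc n)) \<le> K"
  shows "\<exists>C. \<forall>k. \<exists>n\<ge>k. \<exists>m\<ge>k. dist p (u n) + dist p (v m) \<le> dist (u n) (v m) + C \<and>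
    \<bar>dist p (u n) - dist p (v m)\<bar> \<le> K"
proof -
  obtain C N where C: "\<forall>n\<ge>N. \<forall>m\<ge>N. dist p (u n) + dist p (v m) \<le> dist (u n) (v m) + C"
    using gromov_product_bounded[OF \<delta> X u v ne] by (elim exE)
  have "\<exists>n m. k \<le> n \<and> k \<le> m \<and> \<bar>dist p (u n) - dist p (v m)\<bar> \<le> K" for k
  proof -
    obtain m where m: "k \<le> m" "dist p (u k) < dist p (v m)"
      using gromov_converges_boundary_unbounded[OF X v, where k = k and R = "dist p (u k)"] by (elim exE conjE)
    let ?P = "\<lambda>n. k \<le> n \<and> dist p (v m) < dist p (u n)"
    have ex: "\<exists>n. ?P n"
      by (rule gromov_converges_boundary_unbounded[OF X u])
    define n where "n = (LEAST n. ?P n)"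
    have n: "?P n" using LeastI_ex[OF ex] unfolding n_def .
    \<comment> \<open>Thus \<open>n\<close> has a predecessor that is still at least
      \<open>k\<close>, and it violates \<open>?P\<close> by minimality.\<close>
    with m(2) have "n \<noteq> k" by auto
    with n obtain n' where n': "n = Suc n'" "k \<le> n'" by (cases n) auto
    have "\<not> ?P n'" using n'(1) unfolding n_def by (intro not_less_Least) simp
    moreover have "dist p (u n) \<le> dist p (u n') + dist (u n') (u n)" by metric
    ultimately have "\<bar>dist p (u n) - dist p (v m)\<bar> \<le> K"
      using n step[of n'] n' by auto
    with n m(1) show ?thesis by (intro exI[of _ n] exI[of _ m] conjI) simp_all
  qed
  note balanced = this
  have "\<exists>n\<ge>k. \<exists>m\<ge>k. dist p (u n) + dist p (v m) \<le> dist (u n) (v m) + C \<and>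
    \<bar>dist p (u n) - dist p (v m)\<bar> \<le> K" for k
  proof -
    obtain n m where "k + N \<le> n" "k + N \<le> m" "\<bar>dist p (u n) - dist p (v m)\<bar> \<le> K"
      using balanced[of "k + N"] by (elim exE conjE)
    then show ?thesis using C by (intro exI[of _ n] exI[of _ m] conjI) simp_all
  qed
  then show ?thesis by (intro exI[of _ C] allI)
qed

subsection \<open>Limits of 1-Lipschitz maps\<close>

lemma lipschitz_1_dist:
  assumes "1-lipschitz_on UNIV f"
  shows "dist (f x) (f y) \<le> dist x y"
  using lipschitz_onD[OF assms] by simp

lemma lipschitz_1_compose:
  assumes "1-lipschitz_on UNIV f" "1-lipschitz_on UNIV g"
  shows "1-lipschitz_on UNIV (\<lambda>x. f (g x))"
  using order_trans[OF lipschitz_1_dist[OF assms(1)] lipschitz_1_dist[OF assms(2)]]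
  by (intro lipschitz_onI) simp_all

lemma lipschitz_1_funpow:
  fixes f :: "'a::metric_space \<Rightarrow> 'a"
  assumes "1-lipschitz_on UNIV f"
  shows "1-lipschitz_on UNIV (f ^^ n)"
proof (induction n)
  case 0
  then show ?case by (rule lipschitz_onI) auto
next
  case (Suc n)
  then show ?case using lipschitz_1_compose[OF assms Suc] by (simp add: o_def)
qed

lemma lipschitz_1_limit:
  assumes "\<And>k. 1-lipschitz_on UNIV (h k)" "\<And>x. (\<lambda>k. h k x) \<longlonglongrightarrow> l x"
  shows "1-lipschitz_on UNIV l"
proof (rule lipschitz_onI)
  fix x y
  have "(\<lambda>k. dist (h k x) (h k y)) \<longlonglongrightarrow> dist (l x) (l y)"
    by (intro tendsto_dist assms)
  then show "dist (l x) (l y) \<le> 1 * dist x y"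
    using lipschitz_1_dist[OF assms(1)] by (auto intro: LIMSEQ_le_const2)
qed simp

lemma lipschitz_1_tendsto:
  assumes "1-lipschitz_on UNIV f" "s \<longlonglongrightarrow> z"
  shows "(\<lambda>k. f (s k)) \<longlonglongrightarrow> f z"
  using continuous_on_tendsto_compose[OF lipschitz_on_continuous_on[OF assms(1)] assms(2)] by simp

section \<open>Compactness of families of 1-Lipschitz maps on a proper space\<close>

text \<open>Balls of integer radius are totally bounded; the union of their finite nets of mesh
  \<open>1 / (k + 1)\<close> is countable and dense.\<close>

lemma proper_space_dense_seq:
  assumes "proper_space TYPE('a::metric_space)"
  obtains d :: "nat \<Rightarrow> 'a::metric_space" where "\<And>x e. 0 < e \<Longrightarrow> \<exists>i. dist x (d i) < e"
proof -
  fix c :: 'a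
  have "\<exists>F. finite F \<and> cball c (real n) \<subseteq> (\<Union>x\<in>F. ball x (inverse (real (Suc k))))" for n k
    using assms unfolding proper_space_def compact_eq_totally_bounded
    by (metis inverse_positive_iff_positive of_nat_0_less_iff zero_less_Suc)
  then obtain F where F: "\<And>n k. finite (F n k)"
    "\<And>n k. cball c (real n) \<subseteq> (\<Union>x\<in>F n k. ball x (inverse (real (Suc k))))"
    by metis
  \<comment> \<open>Inserting \<open>c\<close> makes the set visibly nonempty, as its enumeration
    requires.\<close>
  let ?D = "insert c (\<Union>n k. F n k)"
  have "countable (F n k)" for n k
    using F(1) by (rule countable_finite)
  then have "countable ?D"
    by (intro countable_insert countable_UN) auto
  then have D: "range (from_nat_into ?D) = ?D"
    by (intro range_from_nat_into) auto
  show ?thesis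
  proof
    fix x :: 'a and e :: real assume "0 < e"
    then obtain k where k: "inverse (real (Suc k)) < e" using reals_Archimedean by blast
    obtain n :: nat where "dist c x \<le> real n" using real_arch_simple by blast
    then have "x \<in> cball c (real n)" by simp
    with F(2)[of n k] obtain y where "y \<in> F n k" "dist y x < inverse (real (Suc k))"
      by fastforce
    moreover then have "y \<in> range (from_nat_into ?D)" unfolding D by blast
    ultimately show "\<exists>i. dist x (from_nat_into ?D i) < e"
      using k by (auto simp: dist_commute) (metis dist_commute order.strict_trans)
  qed
qed

text \<open>An Arzela-Ascoli argument. Boundedness at the single point \<open>y\<close> gives
  boundedness at every point; a subsequence converges on a dense sequence, and equicontinuity
  extends this to all points.\<close>

lemma lipschitz_1_convergent_subseq:
  fixes h :: "nat \<Rightarrow> 'a::metric_space \<Rightarrow> 'a"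
  assumes X: "proper_space TYPE('a)" and lip: "\<And>k. 1-lipschitz_on UNIV (h k)"
    and bd: "\<And>k. dist z (h k y) \<le> R"
  obtains r l where "strict_mono (r :: nat \<Rightarrow> nat)" "\<And>x. (\<lambda>k. h (r k) x) \<longlonglongrightarrow> l x"
proof -
  have bdx: "h k x \<in> cball z (R + dist x y)" for k x
    using bd[of k] lipschitz_1_dist[OF lip, of k x y] dist_triangle[of z "h k x" "h k y"]
    by (simp add: dist_commute)
  obtain d :: "nat \<Rightarrow> 'a" where d: "\<And>x e. 0 < e \<Longrightarrow> \<exists>i. dist x (d i) < e"
    using proper_space_dense_seq[OF X] by blast
  \<comment> \<open>Sequential compactness of this countable product of compact balls replaces the
    diagonal argument.\<close>
  let ?P = "PiE UNIV (\<lambda>i. cball z (R + dist (d i) y))"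
  have "compactin (product_topology (\<lambda>i. euclidean) UNIV) ?P"
    unfolding compactin_PiE using X unfolding proper_space_def by simp
  then have "compact ?P" by (simp add: euclidean_product_topology)
  then have "seq_compact ?P" by (simp add: compact_eq_seq_compact_metric)
  moreover have "(\<lambda>i. h k (d i)) \<in> ?P" for k using bdx by auto
  ultimately obtain L r where r: "strict_mono (r :: nat \<Rightarrow> nat)"
    "((\<lambda>k i. h k (d i)) \<circ> r) \<longlonglongrightarrow> L"
    unfolding seq_compact_def by meson
  have Ld: "(\<lambda>k. h (r k) (d i)) \<longlonglongrightarrow> L i" for i
  proof -
    have "isCont (\<lambda>f :: nat \<Rightarrow> 'a. f i) L"
      using continuous_on_product_coordinates[of i]
      by (metis UNIV_I continuous_on_eq_continuous_at open_UNIV)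
    from isCont_tendsto_compose[OF this r(2)] show ?thesis by (simp add: o_def)
  qed
  have "\<exists>l. (\<lambda>k. h (r k) x) \<longlonglongrightarrow> l" for x
  proof -
    \<comment> \<open>Compare at a nearby dense point \<open>d i\<close>; the Lipschitz bound
      controls the two outer terms.\<close>
    have "Cauchy (\<lambda>k. h (r k) x)"
    proof (rule metric_CauchyI)
      fix e :: real assume e: "0 < e"
      then obtain i where i: "dist x (d i) < e / 3" using d[of "e / 3" x] by auto
      have "Cauchy (\<lambda>k. h (r k) (d i))" using Ld LIMSEQ_imp_Cauchy by blast
      then obtain N where N: "\<And>m n. N \<le> m \<Longrightarrow> N \<le> n \<Longrightarrow> dist (h (r m) (d i)) (h (r n) (d i)) < e / 3"
        using e metric_CauchyD[of "\<lambda>k. h (r k) (d i)" "e / 3"] by auto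
      have "dist (h (r m) x) (h (r n) x) < e" if "N \<le> m" "N \<le> n" for m n
      proof -
        have "dist (h (r m) x) (h (r n) x) \<le> dist (h (r m) x) (h (r m) (d i)) +
            dist (h (r m) (d i)) (h (r n) (d i)) + dist (h (r n) x) (h (r n) (d i))" by metric
        then show ?thesis
          using N[OF that] i lipschitz_1_dist[OF lip, of "r m" x "d i"]
            lipschitz_1_dist[OF lip, of "r n" x "d i"] by linarith
      qed
      then show "\<exists>M. \<forall>m\<ge>M. \<forall>n\<ge>M. dist (h (r m) x) (h (r n) x) < e" by blast
    qed
    moreover have "complete (cball z (R + dist x y))"
      using X compact_imp_complete unfolding proper_space_def by blast
    moreover have "\<forall>k. h (r k) x \<in> cball z (R + dist x y)" using bdx by blast
    ultimately show ?thesis unfolding complete_def by meson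
  qed
  then obtain l where "\<And>x. (\<lambda>k. h (r k) x) \<longlonglongrightarrow> l x" by metis
  with r(1) show ?thesis by (rule that)
qed

subsection \<open>The limit group of two commuting maps\<close>

text \<open>The exponents have to tend to infinity but not to increase, so shifted exponents and
  suitable differences qualify too.\<close>

definition iterate_limits :: "('a::metric_space \<Rightarrow> 'a) \<Rightarrow> ('a \<Rightarrow> 'a) \<Rightarrow> ('a \<Rightarrow> 'a) set" where
  "iterate_limits f g = {h. \<exists>n m. filterlim n at_top sequentially \<and> filterlim m at_top sequentially \<and>
     (\<forall>x. (\<lambda>k. (f ^^ n k) ((g ^^ m k) x)) \<longlonglongrightarrow> h x)}"

lemma funpow_commute:
  assumes "f \<circ> g = g \<circ> f"
  shows "(f ^^ n) ((g ^^ m) x) = (g ^^ m) ((f ^^ n) x)"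
proof -
  have 1: "f ((g ^^ m) x) = (g ^^ m) (f x)" for x m
    using assms by (induction m) (auto simp: fun_eq_iff)
  show ?thesis by (induction n) (auto simp: 1)
qed

lemma iterate_commute:
  assumes "f \<circ> g = g \<circ> f"
  shows "(f ^^ a) ((g ^^ b) ((f ^^ c) ((g ^^ d) x))) = (f ^^ (a + c)) ((g ^^ (b + d)) x)"
  by (simp add: funpow_add funpow_commute[OF assms])

context
  fixes f g :: "'a::metric_space \<Rightarrow> 'a"
  assumes f: "1-lipschitz_on UNIV f" and g: "1-lipschitz_on UNIV g" and fg: "f \<circ> g = g \<circ> f"
begin

lemma iterate_lipschitz: "1-lipschitz_on UNIV (\<lambda>x. (f ^^ n) ((g ^^ m) x))"
  by (rule lipschitz_1_compose[OF lipschitz_1_funpow[OF f] lipschitz_1_funpow[OF g]])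

lemma iterate_limits_lipschitz:
  assumes "h \<in> iterate_limits f g"
  shows "1-lipschitz_on UNIV h"
proof -
  obtain n m where "\<And>x. (\<lambda>k. (f ^^ n k) ((g ^^ m k) x)) \<longlonglongrightarrow> h x"
    using assms unfolding iterate_limits_def by blast
  then show ?thesis by (rule lipschitz_1_limit[OF iterate_lipschitz])
qed

lemma iterate_limits_commute_iterate:
  assumes "h \<in> iterate_limits f g"
  shows "h ((f ^^ a) ((g ^^ b) x)) = (f ^^ a) ((g ^^ b) (h x))"
proof -
  obtain n m where nm: "\<And>x. (\<lambda>k. (f ^^ n k) ((g ^^ m k) x)) \<longlonglongrightarrow> h x"
    using assms unfolding iterate_limits_def by blast
  have "(\<lambda>k. (f ^^ a) ((g ^^ b) ((f ^^ n k) ((g ^^ m k) x)))) \<longlonglongrightarrow> (f ^^ a) ((g ^^ b) (h x))"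
    by (rule lipschitz_1_tendsto[OF iterate_lipschitz nm])
  then have "(\<lambda>k. (f ^^ n k) ((g ^^ m k) ((f ^^ a) ((g ^^ b) x)))) \<longlonglongrightarrow> (f ^^ a) ((g ^^ b) (h x))"
    by (simp add: iterate_commute[OF fg] add.commute)
  then show ?thesis using nm LIMSEQ_unique by blast
qed

text \<open>\<open>h'\<close> commutes with the iterates approximating \<open>h\<close>, and its
  continuity carries this to the limit.\<close>

lemma iterate_limits_commute:
  assumes h: "h \<in> iterate_limits f g" and h': "h' \<in> iterate_limits f g"
  shows "h (h' x) = h' (h x)"
proof -
  obtain n m where nm: "\<And>x. (\<lambda>k. (f ^^ n k) ((g ^^ m k) x)) \<longlonglongrightarrow> h x"
    using h unfolding iterate_limits_def by blast
  have "(\<lambda>k. h' ((f ^^ n k) ((g ^^ m k) x))) \<longlonglongrightarrow> h' (h x)"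
    by (rule lipschitz_1_tendsto[OF iterate_limits_lipschitz[OF h'] nm])
  then have "(\<lambda>k. (f ^^ n k) ((g ^^ m k) (h' x))) \<longlonglongrightarrow> h' (h x)"
    by (simp add: iterate_limits_commute_iterate[OF h'])
  then show ?thesis using nm LIMSEQ_unique by blast
qed

lemma iterate_limits_iterate:
  assumes "h \<in> iterate_limits f g"
  shows "(\<lambda>x. (f ^^ a) ((g ^^ b) (h x))) \<in> iterate_limits f g"
proof -
  obtain n m where nm: "filterlim n at_top sequentially" "filterlim m at_top sequentially"
    "\<And>x. (\<lambda>k. (f ^^ n k) ((g ^^ m k) x)) \<longlonglongrightarrow> h x"
    using assms unfolding iterate_limits_def by blast
  have "(\<lambda>k. (f ^^ (a + n k)) ((g ^^ (b + m k)) x)) \<longlonglongrightarrow> (f ^^ a) ((g ^^ b) (h x))" for x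
    using lipschitz_1_tendsto[OF iterate_lipschitz[of a b] nm(3)[of x]]
    by (simp add: iterate_commute[OF fg])
  moreover have "filterlim (\<lambda>k. a + n k) at_top sequentially" "filterlim (\<lambda>k. b + m k) at_top sequentially"
    using nm(1,2) by (auto intro: filterlim_at_top_mono)
  ultimately show ?thesis unfolding iterate_limits_def by blast
qed

text \<open>Passing from \<open>h'\<close> to a quotient \<open>h' / h\<close> amounts to subtracting exponents: the maps with
  the exponent differences send points near \<open>h x\<close> to points near \<open>h' x\<close>, hence subconverge.\<close>

lemma iterate_limits_divide:
  assumes X: "proper_space TYPE('a)" and h: "h \<in> iterate_limits f g" and h': "h' \<in> iterate_limits f g"
  shows "\<exists>\<phi>\<in>iterate_limits f g. \<forall>x. \<phi> (h x) = h' x"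
proof -
  obtain n m where nm: "filterlim n at_top sequentially" "filterlim m at_top sequentially"
    "\<And>x. (\<lambda>k. (f ^^ n k) ((g ^^ m k) x)) \<longlonglongrightarrow> h x"
    using h unfolding iterate_limits_def by blast
  obtain n' m' where nm': "filterlim n' at_top sequentially" "filterlim m' at_top sequentially"
    "\<And>x. (\<lambda>k. (f ^^ n' k) ((g ^^ m' k) x)) \<longlonglongrightarrow> h' x"
    using h' unfolding iterate_limits_def by blast
  \<comment> \<open>The margin \<open>j\<close> keeps the natural subtractions below exact and
    drives the exponent differences to infinity.\<close>
  have "\<exists>i\<ge>j. n j + j \<le> n' i \<and> m j + j \<le> m' i" for j
  proof -
    have "\<forall>\<^sub>F i in sequentially. j \<le> i \<and> n j + j \<le> n' i \<and> m j + j \<le> m' i"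
      using nm'(1,2) by (intro eventually_conj) (auto simp: filterlim_at_top eventually_ge_at_top)
    then show ?thesis by (auto simp: eventually_sequentially)
  qed
  then obtain i where i: "\<And>j. j \<le> i j" "\<And>j. n j + j \<le> n' (i j)" "\<And>j. m j + j \<le> m' (i j)"
    by metis
  define \<psi> where "\<psi> j = (\<lambda>x. (f ^^ (n' (i j) - n j)) ((g ^^ (m' (i j) - m j)) x))" for j
  have lip: "1-lipschitz_on UNIV (\<psi> j)" for j
    unfolding \<psi>_def by (rule iterate_lipschitz)
  have "filterlim i at_top sequentially"
    using i(1) by (intro filterlim_at_top_mono[OF filterlim_ident]) auto
  then have "(\<lambda>j. (f ^^ n' (i j)) ((g ^^ m' (i j)) x)) \<longlonglongrightarrow> h' x" for x
    by (rule filterlim_compose[OF nm'(3)])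
  moreover have "\<psi> j ((f ^^ n j) ((g ^^ m j) x)) = (f ^^ n' (i j)) ((g ^^ m' (i j)) x)" for j x
    using i(2,3)[of j] by (simp add: \<psi>_def iterate_commute[OF fg])
  ultimately have \<psi>lim: "(\<lambda>j. \<psi> j ((f ^^ n j) ((g ^^ m j) x))) \<longlonglongrightarrow> h' x" for x
    by simp
  \<comment> \<open>Replacing \<open>h x\<close> by its approximant costs at most their distance, as
    \<open>\<psi> j\<close> is 1-Lipschitz.\<close>
  have lim: "(\<lambda>j. \<psi> j (h x)) \<longlonglongrightarrow> h' x" for x
  proof (rule tendsto_dist_iff[THEN iffD2], rule tendsto_sandwich[OF _ _ tendsto_const])
    let ?w = "\<lambda>j. (f ^^ n j) ((g ^^ m j) x)"
    let ?e = "\<lambda>j. dist (?w j) (h x) + dist (\<psi> j (?w j)) (h' x)"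
    show "?e \<longlonglongrightarrow> 0"
      by (rule tendsto_add_zero) (rule tendsto_dist_iff[THEN iffD1, OF nm(3)] tendsto_dist_iff[THEN iffD1, OF \<psi>lim])+
    have "dist (\<psi> j (h x)) (h' x) \<le> ?e j" for j
      using lipschitz_1_dist[OF lip, of j "?w j" "h x"]
        dist_triangle3[of "\<psi> j (h x)" "h' x" "\<psi> j (?w j)"] by linarith
    then show "\<forall>\<^sub>F j in sequentially. dist (\<psi> j (h x)) (h' x) \<le> ?e j" by simp
  qed simp
  \<comment> \<open>An arbitrary point: the convergent sequence \<open>\<psi> j (h y)\<close>
    supplies the bound at one point that subconvergence requires.\<close>
  fix y :: 'a
  have "bounded (range (\<lambda>j. \<psi> j (h y)))"
    using lim convergent_imp_bounded by blast
  then obtain R where "\<And>j. dist y (\<psi> j (h y)) \<le> R"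
    unfolding bounded_any_center[where a = y] by auto
  then obtain r \<phi> where r: "strict_mono (r :: nat \<Rightarrow> nat)" "\<And>x. (\<lambda>k. \<psi> (r k) x) \<longlonglongrightarrow> \<phi> x"
    using lipschitz_1_convergent_subseq[of \<psi>, OF X lip] by metis
  have "\<phi> (h x) = h' x" for x
    using r(2)[of "h x"] LIMSEQ_subseq_LIMSEQ[OF lim r(1), of x] LIMSEQ_unique
    by (auto simp: o_def)
  moreover have "\<phi> \<in> iterate_limits f g"
  proof -
    have "k \<le> n' (i (r k)) - n (r k)" "k \<le> m' (i (r k)) - m (r k)" for k
      using seq_suble[OF r(1), of k] i(2,3)[of "r k"] by linarith+
    then have "filterlim (\<lambda>k. n' (i (r k)) - n (r k)) at_top sequentially"
      "filterlim (\<lambda>k. m' (i (r k)) - m (r k)) at_top sequentially"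
      by (auto intro!: filterlim_at_top_mono[OF filterlim_ident])
    then show ?thesis using r(2) unfolding iterate_limits_def \<psi>_def by blast
  qed
  ultimately show ?thesis by (intro bexI[of _ \<phi>] allI)
qed

text \<open>The identity arises as the quotient \<open>\<rho>\<close> of some \<open>h\<close> by
  itself. Writing \<open>\<rho> = \<phi> \<circ> h\<close>, commutativity gives \<open>\<rho>
  \<circ> \<rho> = \<phi> \<circ> \<rho> \<circ> h = \<phi> \<circ> h = \<rho>\<close>.\<close>

lemma iterate_limits_retraction:
  assumes X: "proper_space TYPE('a)" and ne: "iterate_limits f g \<noteq> {}"
  shows "\<exists>\<rho>\<in>iterate_limits f g. \<forall>x. \<rho> (\<rho> x) = \<rho> x"
proof -
  obtain h where h: "h \<in> iterate_limits f g" using ne by blast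
  obtain \<rho> where \<rho>: "\<rho> \<in> iterate_limits f g" "\<forall>x. \<rho> (h x) = h x"
    using iterate_limits_divide[OF X h h] by (elim bexE)
  obtain \<phi> where \<phi>: "\<phi> \<in> iterate_limits f g" "\<forall>x. \<phi> (h x) = \<rho> x"
    using iterate_limits_divide[OF X h \<rho>(1)] by (elim bexE)
  have "\<rho> (\<rho> x) = \<rho> x" for x
    using iterate_limits_commute[OF \<rho>(1) \<phi>(1), of "h x"] \<rho>(2) \<phi>(2) by simp
  with \<rho>(1) show ?thesis by (intro bexI allI)
qed

text \<open>Dividing \<open>\<rho>\<close> by \<open>F \<circ> \<rho>\<close> gives a 1-Lipschitz
  left inverse \<open>\<phi>\<close> of \<open>F\<close> on the image of \<open>\<rho>\<close>, so
  \<open>F\<close> cannot shrink distances there.\<close>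

lemma iterate_limits_isometry:
  assumes X: "proper_space TYPE('a)"
    and \<rho>: "\<rho> \<in> iterate_limits f g" "\<And>x. \<rho> (\<rho> x) = \<rho> x"
  shows "isometry_of (range \<rho>) (\<lambda>x. (f ^^ a) ((g ^^ b) x))"
proof -
  define F where "F = (\<lambda>x. (f ^^ a) ((g ^^ b) x))"
  have lip: "1-lipschitz_on UNIV F"
    unfolding F_def by (rule iterate_lipschitz)
  have comm: "h (F x) = F (h x)" if "h \<in> iterate_limits f g" for h x
    unfolding F_def by (rule iterate_limits_commute_iterate[OF that])
  have "(\<lambda>x. F (\<rho> x)) \<in> iterate_limits f g"
    unfolding F_def by (rule iterate_limits_iterate[OF \<rho>(1)])
  from iterate_limits_divide[OF X this \<rho>(1)]
  obtain \<phi> where \<phi>: "\<phi> \<in> iterate_limits f g" "\<forall>x. \<phi> (F (\<rho> x)) = \<rho> x"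
    by (elim bexE)
  have iso: "dist (F x) (F y) = dist x y" if "x \<in> range \<rho>" "y \<in> range \<rho>" for x y
  proof (rule antisym)
    show "dist (F x) (F y) \<le> dist x y" by (rule lipschitz_1_dist[OF lip])
    have "\<phi> (F x) = x" "\<phi> (F y) = y" using that \<phi>(2) by auto
    then show "dist x y \<le> dist (F x) (F y)"
      using lipschitz_1_dist[OF iterate_limits_lipschitz[OF \<phi>(1)], of "F x" "F y"] by simp
  qed
  have "F ` range \<rho> = range \<rho>"
  proof
    show "F ` range \<rho> \<subseteq> range \<rho>"
      using comm[OF \<rho>(1), symmetric] by auto
    show "range \<rho> \<subseteq> F ` range \<rho>"
    proof
      fix y assume "y \<in> range \<rho>"
      then obtain x where x: "y = \<rho> x" by blast
      \<comment> \<open>Moving \<open>\<phi>\<close> past \<open>F\<close> and \<open>\<rho>\<close>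
        exhibits a preimage of \<open>\<rho> x\<close> in the image of
        \<open>\<rho>\<close>.\<close>
      have "\<rho> x = \<phi> (F (\<rho> (\<rho> x)))" by (simp only: \<phi>(2)[rule_format] \<rho>(2))
      also have "\<dots> = F (\<rho> (\<phi> (\<rho> x)))"
        by (simp only: comm[OF \<phi>(1)] iterate_limits_commute[OF \<phi>(1) \<rho>(1)])
      finally show "y \<in> F ` range \<rho>" unfolding x by (rule image_eqI) (rule rangeI)
    qed
  qed
  moreover have "inj_on F (range \<rho>)"
  proof (rule inj_onI)
    fix x y assume xy: "x \<in> range \<rho>" "y \<in> range \<rho>" "F x = F y"
    then have "dist x y = 0" using iso[OF xy(1,2)] by simp
    then show "x = y" by simp
  qed
  ultimately have "isometry_of (range \<rho>) F"
    unfolding isometry_of_def bij_betw_def isometric_on_def by (intro conjI ballI iso)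
  then show ?thesis unfolding F_def .
qed

text \<open>By commutativity, \<open>f\<^sup>n (g\<^sup>m x)\<close> is at distance at most \<open>dist x (g\<^sup>m x)\<close> from \<open>f\<^sup>n x\<close>
  and at most \<open>dist x (f\<^sup>n x)\<close> from \<open>g\<^sup>m x\<close>.\<close>

lemma iterate_limits_nonempty:
  assumes X: "proper_space TYPE('a)" and geo: "geodesic_space TYPE('a)" and \<delta>: "slim TYPE('a) \<delta>"
    and F: "gromov_converges p (\<lambda>n. Point ((f ^^ n) x)) (Bdry \<xi>)"
    and G: "gromov_converges p (\<lambda>n. Point ((g ^^ n) x)) (Bdry \<eta>)"
    and ne: "\<xi> \<noteq> \<eta>"
  shows "iterate_limits f g \<noteq> {}"
proof -
  define K where "K = dist x (f x)"
  \<comment> \<open>Consecutive points of the orbit are the images of \<open>x\<close> and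
    \<open>f x\<close> under the 1-Lipschitz map \<open>f ^^ n\<close>.\<close>
  have "dist ((f ^^ n) x) ((f ^^ Suc n) x) \<le> K" for n
    unfolding K_def funpow_Suc_right o_apply by (rule lipschitz_1_dist[OF lipschitz_1_funpow[OF f]])
  from gromov_converges_boundary_balanced[of \<delta> p "\<lambda>n. (f ^^ n) x" \<xi> "\<lambda>n. (g ^^ n) x", OF \<delta> geo F G ne this]
  obtain C where "\<forall>k. \<exists>n\<ge>k. \<exists>m\<ge>k. dist p ((f ^^ n) x) + dist p ((g ^^ m) x) \<le>
      dist ((f ^^ n) x) ((g ^^ m) x) + C \<and> \<bar>dist p ((f ^^ n) x) - dist p ((g ^^ m) x)\<bar> \<le> K"
    by (elim exE)
  then obtain n m where n: "\<And>k. k \<le> n k" and m: "\<And>k. k \<le> m k"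
    and C: "\<And>k. dist p ((f ^^ n k) x) + dist p ((g ^^ m k) x) \<le> dist ((f ^^ n k) x) ((g ^^ m k) x) + C"
    and K: "\<And>k. \<bar>dist p ((f ^^ n k) x) - dist p ((g ^^ m k) x)\<bar> \<le> K"
    by metis
  \<comment> \<open>The exchange bound is used with \<open>D = dist p x\<close>, the cost of
    measuring from \<open>p\<close> instead of the orbit's starting point \<open>x\<close>.\<close>
  have bd: "dist p ((f ^^ n k) ((g ^^ m k) x)) \<le> K + 5 * C + 5 * dist p x + 12 * \<delta> + 12" for k
  proof (rule slim_exchange[OF \<delta> geo])
    let ?u = "(f ^^ n k) x" and ?v = "(g ^^ m k) x" and ?z = "(f ^^ n k) ((g ^^ m k) x)"
    show "dist ?u p + dist p ?v \<le> dist ?u ?v + C"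
      using C[of k] by (simp add: dist_commute)
    have "dist ?u ?z \<le> dist x ?v" by (rule lipschitz_1_dist[OF lipschitz_1_funpow[OF f]])
    then show "dist ?u ?z \<le> dist p ?v + dist p x"
      using dist_triangle3[of x ?v p] by linarith
    have "dist ?z ?v \<le> dist ?u x"
      unfolding funpow_commute[OF fg] by (rule lipschitz_1_dist[OF lipschitz_1_funpow[OF g]])
    then show "dist ?z ?v \<le> dist ?u p + dist p x"
      using dist_triangle[of ?u x p] by linarith
    show "\<bar>dist ?u p - dist p ?v\<bar> \<le> K" using K[of k] by (simp add: dist_commute)
  qed
  define h where "h k = (\<lambda>y. (f ^^ n k) ((g ^^ m k) y))" for k
  have "1-lipschitz_on UNIV (h k)" "dist p (h k x) \<le> K + 5 * C + 5 * dist p x + 12 * \<delta> + 12" for k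
    unfolding h_def by (rule iterate_lipschitz, rule bd)
  then obtain r l where r: "strict_mono (r :: nat \<Rightarrow> nat)" "\<And>y. (\<lambda>k. h (r k) y) \<longlonglongrightarrow> l y"
    using lipschitz_1_convergent_subseq[OF X] by metis
  have "k \<le> n (r k)" "k \<le> m (r k)" for k
    using seq_suble[OF r(1), of k] n[of "r k"] m[of "r k"] by linarith+
  then have "filterlim (\<lambda>k. n (r k)) at_top sequentially" "filterlim (\<lambda>k. m (r k)) at_top sequentially"
    by (auto intro!: filterlim_at_top_mono[OF filterlim_ident])
  with r(2) have "l \<in> iterate_limits f g" unfolding iterate_limits_def h_def by blast
  then show ?thesis by blast
qed

end

section \<open>Images of 1-Lipschitz retractions, and the conclusion\<close>

text \<open>Apply \<open>\<rho>\<close> to a geodesic between two fixed points. No piece gets longer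
  and the endpoints stay put, so by the triangle inequality no piece gets shorter.\<close>

lemma retract_totally_geodesic:
  fixes \<rho> :: "'a::metric_space \<Rightarrow> 'a"
  assumes X: "geodesic_space TYPE('a)" and lip: "1-lipschitz_on UNIV \<rho>"
    and \<rho>: "\<And>x. \<rho> (\<rho> x) = \<rho> x"
  shows "totally_geodesic (range \<rho>)"
  unfolding totally_geodesic_def
proof (intro ballI)
  fix x y assume "x \<in> range \<rho>" "y \<in> range \<rho>"
  then have fixed: "\<rho> x = x" "\<rho> y = y" using \<rho> by auto
  obtain G where "geodesic_between G x y" using X unfolding geodesic_space_def by blast
  then obtain \<gamma> where g: "segment_param \<gamma> x y" by (rule geodesic_between_param)
  then have ends: "\<gamma> 0 = x" "\<gamma> (dist x y) = y" unfolding segment_param_def by auto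
  have "dist (\<rho> (\<gamma> s)) (\<rho> (\<gamma> t)) = \<bar>s - t\<bar>" if "s \<in> {0..dist x y}" "t \<in> {0..dist x y}" "s \<le> t" for s t
  proof -
    have "dist (\<rho> (\<gamma> s)) (\<rho> (\<gamma> t)) \<le> \<bar>s - t\<bar>"
      using lipschitz_1_dist[OF lip, of "\<gamma> s" "\<gamma> t"] segment_param_dist[OF g that(1,2)] by simp
    moreover have "dist x (\<rho> (\<gamma> s)) \<le> s"
      using lipschitz_1_dist[OF lip, of x "\<gamma> s"] segment_param_dist[OF g, of 0 s] that ends fixed by auto
    moreover have "dist (\<rho> (\<gamma> t)) y \<le> dist x y - t"
      using lipschitz_1_dist[OF lip, of "\<gamma> t" y] segment_param_dist[OF g, of t "dist x y"] that ends fixed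
      by auto
    moreover have "dist x y \<le> dist x (\<rho> (\<gamma> s)) + dist (\<rho> (\<gamma> s)) (\<rho> (\<gamma> t)) + dist (\<rho> (\<gamma> t)) y"
      by metric
    ultimately show ?thesis using that(3) by linarith
  qed
  then have "isometric_on {0..dist x y} (\<lambda>t. \<rho> (\<gamma> t))"
    unfolding isometric_on_def by (metis dist_commute dist_real_def linear)
  then have "segment_param (\<lambda>t. \<rho> (\<gamma> t)) x y"
    unfolding segment_param_def using ends fixed by simp
  from segment_param_geodesic[OF this] show "\<exists>G. geodesic_between G x y \<and> G \<subseteq> range \<rho>"
    by blast
qed

theorem theorem1p9:
  fixes f g :: "'a::metric_space \<Rightarrow> 'a"
    and p x\<^sub>0 :: 'a
    and \<xi>\<^sub>f \<xi>\<^sub>g :: "(real \<Rightarrow> 'a) set"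
  assumes "proper_space TYPE('a)"
    and "geodesic_space TYPE('a)"
    and "gromov_hyperbolic TYPE('a)"
    and "1-lipschitz_on UNIV f"
    and "1-lipschitz_on UNIV g"
    and "f \<circ> g = g \<circ> f"
    and "\<xi>\<^sub>f \<in> gromov_boundary p"
    and "\<xi>\<^sub>g \<in> gromov_boundary p"
    and "\<xi>\<^sub>f \<noteq> \<xi>\<^sub>g"
    and "gromov_converges p (\<lambda>n. Point ((f ^^ n) x\<^sub>0)) (Bdry \<xi>\<^sub>f)"
    and "gromov_converges p (\<lambda>n. Point ((g ^^ n) x\<^sub>0)) (Bdry \<xi>\<^sub>g)"
  shows "\<exists>(M :: 'a set) \<rho> :: 'a \<Rightarrow> 'a.
           totally_geodesic M \<and> closed M \<and>
           range \<rho> \<subseteq> M \<and> 1-lipschitz_on UNIV \<rho> \<and>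
           \<rho> \<circ> \<rho> = \<rho> \<and>
           f ` M = M \<and> g ` M = M \<and>
           isometry_of M f \<and> isometry_of M g"
proof -
  obtain \<delta> where \<delta>: "slim TYPE('a) \<delta>"
    using gromov_hyperbolic_slim[OF assms(3)] .
  have "iterate_limits f g \<noteq> {}"
    using iterate_limits_nonempty[OF assms(4-6,1,2) \<delta> assms(10,11,9)] .
  from iterate_limits_retraction[OF assms(4-6,1) this]
  obtain \<rho> where \<rho>: "\<rho> \<in> iterate_limits f g" "\<forall>x. \<rho> (\<rho> x) = \<rho> x"
    by (elim bexE)
  note idem = \<rho>(2)[rule_format]
  have lip: "1-lipschitz_on UNIV \<rho>"
    using iterate_limits_lipschitz[OF assms(4-6) \<rho>(1)] .
  \<comment> \<open>As the fixed point set of a continuous map, the image is closed.\<close>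
  have fixed: "range \<rho> = {x. \<rho> x = x}"
    using idem by (auto simp: image_iff intro: sym)
  have cl: "closed (range \<rho>)"
    unfolding fixed using lipschitz_on_continuous_on[OF lip]
    by (intro closed_Collect_eq continuous_intros)
  \<comment> \<open>The exponent pairs (1, 0) and (0, 1) give \<open>f\<close> and
    \<open>g\<close>.\<close>
  have iso: "isometry_of (range \<rho>) f" "isometry_of (range \<rho>) g"
    using iterate_limits_isometry[OF assms(4-6,1) \<rho>(1) idem, of 1 0]
      iterate_limits_isometry[OF assms(4-6,1) \<rho>(1) idem, of 0 1] by simp_all
  then have im: "f ` range \<rho> = range \<rho>" "g ` range \<rho> = range \<rho>"
    unfolding isometry_of_def bij_betw_def by simp_all
  have "totally_geodesic (range \<rho>)"
    using retract_totally_geodesic[OF assms(2) lip idem] .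
  moreover have "\<rho> \<circ> \<rho> = \<rho>" by (rule ext) (simp add: idem)
  ultimately show ?thesis
    by (intro exI[of _ "range \<rho>"] exI[of _ \<rho>] conjI cl lip im iso order_refl)
qed

end
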